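(* Let $p\in(1,\infty)$, let $p'=\frac{p}{p-1}$, let $H$ be the Hilbert transform on $\mathbb{R}$, and let $b(x)=\log|x|$ on $\mathbb{R}$. For $t\ge 1$ define $$\varphi_{\log|\cdot|,H}(t):=\sup_{\substack{w\in A_p\\ [w]_{A_p}\le t}}\big\|[\log|\cdot|,H]\big\|_{L^p(w)\to L^{p,\infty}(w)} .$$ Then there exists a constant $c>0$, depending only on $p$, such that for all $t\ge 1$ $$\varphi_{\log|\cdot|,H}(t)\ \ge\ c\,t^{\max\left(2,\ \frac1p+\frac{p'}{p}\right)} .$$
   Context: $Hf(x)=\frac1\pi\,\mathrm{p.v.}\int_{\mathbb{R}}\frac{f(y)}{x-y}\,dy$. A weight is a locally integrable function on $\mathbb{R}$ that is positive almost everywhere. For a measurable set $A$, $w(A)=\int_A w\,dx$. For $p\in(1,\infty)$, $w\in A_p$ means that $w$ is a weight with $[w]_{A_p}:=\sup_Q \langle w\rangle_Q\langle w^{1-p'}\rangle_Q^{p-1}<\infty$, the supremum being over all bounded intervals $Q\subseteq\mathbb{R}$, where $\langle g\rangle_Q=\frac1{|Q|}\int_Q g\,dx$. $\|f\|_{L^p(w)}=\left(\int|f|^pw\,dx\right)^{1/p}$ and $\|f\|_{L^{p,\infty}(w)}=\sup_{\lambda>0}\lambda\, w(\{x:|f(x)|>\lambda\})^{1/p}$. The commutator is $[b,H]f=b\,H(f)-H(bf)$, defined by this formula for compactly supported $f\in\bigcup_{q\in(1,\infty)}L^q(\mathbb{R})$. The quantity $\|[b,H]\|_{L^p(w)\to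 L^{p,\infty}(w)}$ is the infimum of all $C>0$ such that $\|[b,H]f\|_{L^{p,\infty}(w)}\le C\|f\|_{L^p(w)}$ for all $f\in L^p(w)$, and is $\infty$ if there is no such $C$; the inequality is understood for compactly supported $f\in L^p(w)$ (a dense class, contained in the set of compactly supported functions in $\bigcup_{q\in(1,\infty)}L^q(\mathbb{R})$ when $w\in A_p$). *)

theory Defs
  imports "HOL-Analysis.Analysis"
begin

text \<open>Quantities that may be infinite take values in \<^typ>\<open>ennreal\<close>. Functions are only required to be
  Lebesgue measurable, so integrals are taken with respect to \<^const>\<open>lebesgue\<close>.\<close>

text \<open>Real powers of extended nonnegative reals; only meant for exponents \<open>a > 0\<close>.\<close>

definition ennpowr :: "ennreal \<Rightarrow> real \<Rightarrow> ennreal" (infixr "ennpowr" 80) where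
  "x ennpowr a = (if x = \<infinity> then \<infinity> else ennreal (enn2real x powr a))"

definition conj_exp :: "real \<Rightarrow> real" where
  "conj_exp p = p / (p - 1)"

definition weight :: "(real \<Rightarrow> real) \<Rightarrow> bool" where
  "weight w \<longleftrightarrow> (\<forall>K. compact K \<longrightarrow> set_integrable lebesgue K w) \<and> (AE x in lebesgue. 0 < w x)"

definition wmeasure :: "(real \<Rightarrow> real) \<Rightarrow> real set \<Rightarrow> ennreal" where
  "wmeasure w A = (\<integral>\<^sup>+x\<in>A. ennreal (w x) \<partial>lebesgue)"

definition avg :: "real \<Rightarrow> real \<Rightarrow> (real \<Rightarrow> real) \<Rightarrow> ennreal" where
  "avg u v g = (\<integral>\<^sup>+x\<in>{u..v}. ennreal (g x) \<partial>lebesgue) / ennreal (v - u)"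

text \<open>Closed intervals represent all bounded intervals of positive length, since endpoints are null sets.\<close>

definition Ap_const :: "real \<Rightarrow> (real \<Rightarrow> real) \<Rightarrow> ennreal" where
  "Ap_const p w = (SUP (u, v) \<in> {(u, v). u < v}.
     avg u v w * (avg u v (\<lambda>x. w x powr (1 - conj_exp p))) ennpowr (p - 1))"

definition Ap :: "real \<Rightarrow> (real \<Rightarrow> real) set" where
  "Ap p = {w. weight w \<and> Ap_const p w < \<infinity>}"

definition Lp_norm :: "real \<Rightarrow> (real \<Rightarrow> real) \<Rightarrow> (real \<Rightarrow> real) \<Rightarrow> ennreal" where
  "Lp_norm p w f = (\<integral>\<^sup>+x. ennreal (\<bar>f x\<bar> powr p * w x) \<partial>lebesgue) ennpowr (1 / p)"

definition Lp_space :: "real \<Rightarrow> (real \<Rightarrow> real) \<Rightarrow> (real \<Rightarrow> real) set" where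
  "Lp_space p w = {f. f \<in> borel_measurable lebesgue \<and> Lp_norm p w f < \<infinity>}"

definition weak_Lp_norm :: "real \<Rightarrow> (real \<Rightarrow> real) \<Rightarrow> (real \<Rightarrow> real) \<Rightarrow> ennreal" where
  "weak_Lp_norm p w f =
     (SUP l \<in> {0<..}. ennreal l * (wmeasure w {x. \<bar>f x\<bar> > l}) ennpowr (1 / p))"

definition compactly_supported :: "(real \<Rightarrow> real) \<Rightarrow> bool" where
  "compactly_supported f \<longleftrightarrow> compact (closure {x. f x \<noteq> 0})"

text \<open>For compactly supported \<open>f\<close> in \<open>L\<^sup>q\<close>, \<open>q > 1\<close>, the limit exists for almost every \<open>x\<close>;
  elsewhere \<^const>\<open>Lim\<close> gives an unspecified value.\<close>

definition hilbert :: "(real \<Rightarrow> real) \<Rightarrow> real \<Rightarrow> real" where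
  "hilbert f x =
     1 / pi * Lim (at_right 0) (\<lambda>e. LINT y:{y. e < \<bar>x - y\<bar>}|lebesgue. f y / (x - y))"

definition commutator ::
  "(real \<Rightarrow> real) \<Rightarrow> ((real \<Rightarrow> real) \<Rightarrow> real \<Rightarrow> real) \<Rightarrow> (real \<Rightarrow> real) \<Rightarrow> real \<Rightarrow> real" where
  "commutator b T f = (\<lambda>x. b x * T f x - T (\<lambda>y. b y * f y) x)"

text \<open>The weak-type inequality is tested on compactly supported \<open>f \<in> L\<^sup>p(w)\<close>. The infimum of the
  empty set is \<open>\<infinity>\<close> in \<^typ>\<open>ennreal\<close>.\<close>

definition weak_op_norm :: "real \<Rightarrow> (real \<Rightarrow> real) \<Rightarrow> ((real \<Rightarrow> real) \<Rightarrow> real \<Rightarrow> real) \<Rightarrow> ennreal" where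
  "weak_op_norm p w S = Inf {ennreal C |C. 0 < C \<and>
     (\<forall>f \<in> Lp_space p w. compactly_supported f \<longrightarrow>
        weak_Lp_norm p w (S f) \<le> ennreal C * Lp_norm p w f)}"

definition phi ::
  "real \<Rightarrow> (real \<Rightarrow> real) \<Rightarrow> ((real \<Rightarrow> real) \<Rightarrow> real \<Rightarrow> real) \<Rightarrow> real \<Rightarrow> ennreal" where
  "phi p b T t =
     (SUP w \<in> {w \<in> Ap p. Ap_const p w \<le> ennreal t}. weak_op_norm p w (commutator b T))"

end

theory Submission
  imports Defs
begin

text \<open>Write \<open>b = ln \<bar>\<cdot>\<bar>\<close>. Off the support of \<open>f\<close> the commutator has the kernel
  \<open>(b x - b y) / (\<pi> (x - y))\<close>, which is positive for \<open>x, y > 0\<close> because the logarithm is increasing.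
  Nothing cancels when \<open>f \<ge> 0\<close>, so lower bounds only require choosing weights and test functions
  for which the kernel is large. With a parameter \<open>L \<ge> 1\<close> and \<open>s = exp (-L)\<close>, power weights whose
  exponents are nearly critical provide two examples.

  The first, \<open>w x = \<bar>x\<bar> powr (1 / L - 1)\<close>, is barely integrable at the origin, and \<open>[w] \<le> 4 L\<close>. For
  \<open>f = indicator {s..1}\<close> and \<open>0 < x < s\<close> the commutator is at least
  \<open>(1 / \<pi>) \<integral>\<^sub>s\<^sup>1 ln (y / s) / y dy = L\<^sup>2 / (2 \<pi>)\<close>. Both \<open>w {0<..<s}\<close> and \<open>\<integral> \<bar>f\<bar> powr p * w\<close> are
  comparable to \<open>L\<close>, so the weak operator norm is at least a multiple of \<open>L\<^sup>2\<close>, that is, of \<open>[w]\<^sup>2\<close>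
  (\<open>weak_op_norm_singular_power_ge\<close>).

  In the second, \<open>w x = \<bar>x\<bar> powr ((p - 1) * (1 - 1 / L))\<close>, it is the dual weight that is barely
  integrable, and \<open>[w] \<le> (4 L) powr (p - 1)\<close>. For \<open>f y = 1 / y\<close> on \<open>{s..1}\<close> the commutator is at least
  a multiple of \<open>\<integral>\<^sub>s\<^sup>1 ln (1 / y) / y dy = L\<^sup>2 / 2\<close> on \<open>{1<..<2}\<close>, whereas \<open>\<integral> \<bar>f\<bar> powr p * w\<close> is at most
  a multiple of \<open>L\<close>. The weak operator norm is then at least a multiple of \<open>L powr (2 - 1 / p)\<close>
  (\<open>weak_op_norm_degenerate_power_ge\<close>). In terms of \<open>t = L powr (p - 1)\<close> this is the power
  \<open>(2 - 1 / p) / (p - 1) = 1 / p + 1 / (p - 1)\<close> of \<open>t\<close>, and \<open>1 / (p - 1) = conj_exp p / p\<close>.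

  In both examples \<open>s\<close> is chosen so that \<open>x powr (1 / L)\<close> stays between \<open>exp (-1)\<close> and \<open>1\<close> on
  \<open>{s..1}\<close>. There the weights can be replaced by critical powers at the cost of a
  constant. Since \<open>f\<close> lives on \<open>{s..1}\<close> and is tested outside that
  interval, no principal value has to be evaluated.\<close>

section \<open>Extended real powers and the weak operator norm\<close>

lemma ennpowr_mono:
  assumes "x \<le> y" "0 < a"
  shows "x ennpowr a \<le> y ennpowr a"
proof (cases "y = \<infinity>")
  case False
  moreover from this assms have "x \<noteq> \<infinity>"
    by (auto simp: top_unique)
  ultimately show ?thesis
    using assms unfolding ennpowr_def
    by (auto intro!: ennreal_leI powr_mono2 enn2real_mono simp: top.not_eq_extremum)
qed (simp add: ennpowr_def)

lemma ennpowr_ennreal: "0 \<le> r \<Longrightarrow> ennreal r ennpowr a = ennreal (r powr a)"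
  by (simp add: ennpowr_def)

text \<open>The shape in which a single test function bounds the operator norm: the weak norm is tested at
  the one level \<open>l\<close>, and only on the part \<open>A\<close> of the level set.\<close>

lemma weak_op_norm_ge:
  assumes p: "1 < p"
    and f: "f \<in> borel_measurable lebesgue" "compactly_supported f"
    and N: "(\<integral>\<^sup>+x. ennreal (\<bar>f x\<bar> powr p * w x) \<partial>lebesgue) \<le> ennreal N" "0 < N"
    and A: "\<And>x. x \<in> A \<Longrightarrow> l < S f x" "ennreal m \<le> wmeasure w A"
    and lm: "0 < l" "0 < m"
  shows "ennreal (l * (m / N) powr (1 / p)) \<le> weak_op_norm p w S"
proof -
  have norm: "Lp_norm p w f \<le> ennreal (N powr (1 / p))"
    using ennpowr_mono[OF N(1), of "1 / p"] p N(2) by (simp add: Lp_norm_def ennpowr_ennreal)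
  then have Lp: "f \<in> Lp_space p w"
    using f by (auto simp: Lp_space_def intro: le_less_trans)
  have "A \<subseteq> {x. l < \<bar>S f x\<bar>}"
    using A(1) by force
  then have "wmeasure w A \<le> wmeasure w {x. l < \<bar>S f x\<bar>}"
    unfolding wmeasure_def by (intro nn_integral_mono) (auto simp: indicator_def)
  with A(2) have "ennreal m \<le> wmeasure w {x. l < \<bar>S f x\<bar>}"
    by (rule order_trans)
  then have "ennreal m ennpowr (1 / p) \<le> (wmeasure w {x. l < \<bar>S f x\<bar>}) ennpowr (1 / p)"
    using p by (intro ennpowr_mono) auto
  then have "ennreal l * ennreal (m powr (1 / p))
      \<le> ennreal l * (wmeasure w {x. l < \<bar>S f x\<bar>}) ennpowr (1 / p)"
    using lm by (intro mult_left_mono) (auto simp: ennpowr_ennreal)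
  also have "\<dots> \<le> weak_Lp_norm p w (S f)"
    unfolding weak_Lp_norm_def using lm by (intro SUP_upper) auto
  finally have weak: "ennreal (l * m powr (1 / p)) \<le> weak_Lp_norm p w (S f)"
    using lm by (simp add: ennreal_mult)
  have "ennreal (l * (m / N) powr (1 / p)) \<le> ennreal C"
    if C: "0 < C" and bound: "\<forall>f \<in> Lp_space p w. compactly_supported f \<longrightarrow>
        weak_Lp_norm p w (S f) \<le> ennreal C * Lp_norm p w f" for C
  proof -
    have "ennreal (l * m powr (1 / p)) \<le> ennreal C * Lp_norm p w f"
      using weak bound Lp f(2) by (blast intro: order_trans)
    also have "\<dots> \<le> ennreal C * ennreal (N powr (1 / p))"
      by (intro mult_left_mono norm) auto
    finally have "l * m powr (1 / p) \<le> C * N powr (1 / p)"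
      using C by (simp add: ennreal_mult[symmetric])
    then show ?thesis
      using N(2) lm by (intro ennreal_leI) (simp add: powr_divide field_simps)
  qed
  then show ?thesis
    unfolding weak_op_norm_def by (intro Inf_greatest) auto
qed

section \<open>The commutator away from the support\<close>

text \<open>The truncated integrals do not depend on the truncation once it is smaller than the distance
  from \<open>x\<close> to the support, so the principal value is an ordinary integral.\<close>

lemma hilbert_off_support:
  assumes supp: "\<And>y. y \<notin> {a..b} \<Longrightarrow> f y = 0" and x: "x \<notin> {a..b}"
    and cont: "continuous_on {a..b} f"
  shows "hilbert f x = 1 / pi * integral {a..b} (\<lambda>y. f y / (x - y))"
proof -
  \<comment> \<open>the distance from \<open>x\<close> to \<open>{a..b}\<close>, if that interval is nonempty\<close>
  define e0 where "e0 = max (a - x) (x - b)"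
  have "eventually (\<lambda>e. e < e0 \<or> b < a) (at_right 0)"
  proof (cases "b < a")
    case False
    with x have "0 < e0" by (auto simp: e0_def)
    then show ?thesis
      by (auto intro: eventually_at_right_less simp: eventually_at_right)
  qed simp
  then have "eventually (\<lambda>e. (LINT y:{y. e < \<bar>x - y\<bar>}|lebesgue. f y / (x - y))
      = (LINT y:{a..b}|lebesgue. f y / (x - y))) (at_right 0)"
  proof eventually_elim
    case (elim e)
    then have "indicator {y. e < \<bar>x - y\<bar>} y *\<^sub>R (f y / (x - y))
        = indicator {a..b} y *\<^sub>R (f y / (x - y))" for y
      using supp[of y] x by (auto simp: indicator_def e0_def)
    then show ?case
      unfolding set_lebesgue_integral_def by (intro Bochner_Integration.integral_cong refl)
  qed
  then have "Lim (at_right 0) (\<lambda>e. LINT y:{y. e < \<bar>x - y\<bar>}|lebesgue. f y / (x - y))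
      = (LINT y:{a..b}|lebesgue. f y / (x - y))"
    by (intro tendsto_Lim tendsto_eventually) auto
  moreover have "continuous_on {a..b} (\<lambda>y. f y / (x - y))"
    using x by (intro continuous_intros cont) auto
  then have "(\<lambda>y. f y / (x - y)) absolutely_integrable_on {a..b}"
    by (rule absolutely_integrable_continuous_real)
  ultimately show ?thesis
    by (simp add: hilbert_def set_lebesgue_integral_eq_integral)
qed

text \<open>Off the support both Hilbert transforms are ordinary integrals and combine into one with kernel
  \<open>(ln x - ln y) / (x - y)\<close>. A pointwise minorant \<open>h\<close> of the integrand with a known integral then
  bounds the commutator.\<close>

lemma commutator_log_ge:
  assumes supp: "\<And>y. y \<notin> {a..b} \<Longrightarrow> f y = 0" and cont: "continuous_on {a..b} f"
    and a: "0 < a" and x: "0 < x" "x \<notin> {a..b}"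
    and h: "(h has_integral I) {a..b}"
      "\<And>y. y \<in> {a..b} \<Longrightarrow> h y \<le> (ln x - ln y) * f y / (x - y)"
  shows "I / pi \<le> commutator (\<lambda>x. ln \<bar>x\<bar>) hilbert f x"
proof -
  have c1: "continuous_on {a..b} (\<lambda>y. ln x * (f y / (x - y)))"
    using x by (intro continuous_intros cont) auto
  have c3: "continuous_on {a..b} (\<lambda>y. ln \<bar>y\<bar> * f y)"
    using x a by (intro continuous_intros cont) auto
  have c2: "continuous_on {a..b} (\<lambda>y. ln \<bar>y\<bar> * f y / (x - y))"
    using x by (intro continuous_intros c3) auto
  note int = c1[THEN integrable_continuous_interval] c2[THEN integrable_continuous_interval]
  have "I \<le> integral {a..b} (\<lambda>y. ln x * (f y / (x - y)) - ln \<bar>y\<bar> * f y / (x - y))"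
  proof (rule has_integral_le[OF h(1)])
    show "((\<lambda>y. ln x * (f y / (x - y)) - ln \<bar>y\<bar> * f y / (x - y)) has_integral
        integral {a..b} (\<lambda>y. ln x * (f y / (x - y)) - ln \<bar>y\<bar> * f y / (x - y))) {a..b}"
      by (intro integrable_integral integrable_diff int)
    show "h y \<le> ln x * (f y / (x - y)) - ln \<bar>y\<bar> * f y / (x - y)" if "y \<in> {a..b}" for y
      using h(2)[OF that] that a by (simp add: left_diff_distrib diff_divide_distrib)
  qed
  also have "\<dots> = ln x * integral {a..b} (\<lambda>y. f y / (x - y))
      - integral {a..b} (\<lambda>y. ln \<bar>y\<bar> * f y / (x - y))"
    by (simp only: integral_diff[OF int] integral_mult_right)
  also have "\<dots> = pi * commutator (\<lambda>x. ln \<bar>x\<bar>) hilbert f x"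
    using x hilbert_off_support[of a b f x, OF supp _ cont]
      hilbert_off_support[of a b "\<lambda>y. ln \<bar>y\<bar> * f y" x, OF _ _ c3] supp
    by (simp add: commutator_def field_simps)
  finally show ?thesis
    by (simp add: field_simps)
qed

section \<open>Power weights\<close>

lemma nn_integral_lebesgue_has_integral:
  fixes f :: "real \<Rightarrow> real"
  assumes "\<And>x. x \<in> A \<Longrightarrow> 0 \<le> f x" "(f has_integral I) A"
  shows "(\<integral>\<^sup>+x\<in>A. ennreal (f x) \<partial>lebesgue) = ennreal I"
  using nn_integral_has_integral_lebesgue'[OF assms] by (simp add: nn_integral_completion)

lemma set_nn_integral_mono:
  assumes "\<And>x. x \<in> A \<Longrightarrow> f x \<le> g x" "A \<subseteq> B"
  shows "(\<integral>\<^sup>+x\<in>A. f x \<partial>M) \<le> (\<integral>\<^sup>+x\<in>B. g x \<partial>M)"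
  using assms by (intro nn_integral_mono) (auto simp: indicator_def)

lemma nn_integral_abs_powr:
  assumes "a < 1" "0 \<le> M"
  shows "(\<integral>\<^sup>+x\<in>{-M..M}. ennreal (\<bar>x\<bar> powr (-a)) \<partial>lebesgue)
    = ennreal (2 * M powr (1 - a) / (1 - a))"
proof (rule nn_integral_lebesgue_has_integral)
  have pos: "((\<lambda>x. \<bar>x\<bar> powr (-a)) has_integral (M powr (1 - a) / (1 - a))) {0..M}"
    using has_integral_powr_from_0[of "-a" M] assms
    by (subst has_integral_cong[where g = "\<lambda>x. x powr (-a)"]) (auto simp: algebra_simps)
  then have "((\<lambda>x. \<bar>x\<bar> powr (-a)) has_integral (M powr (1 - a) / (1 - a))) {-M..0}"
    using has_integral_reflect_lemma_real[OF pos] by simp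
  from has_integral_combine[OF _ _ this pos]
  show "((\<lambda>x. \<bar>x\<bar> powr (-a)) has_integral 2 * M powr (1 - a) / (1 - a)) {-M..M}"
    using assms by simp
qed simp

lemma avg_le:
  assumes "u < v" "0 \<le> K" "\<And>x. x \<in> {u..v} \<Longrightarrow> g x \<le> K"
  shows "avg u v g \<le> ennreal K"
proof -
  have "(\<integral>\<^sup>+x\<in>{u..v}. ennreal (g x) \<partial>lebesgue) \<le> (\<integral>\<^sup>+x\<in>{u..v}. ennreal K \<partial>lebesgue)"
    using assms by (intro set_nn_integral_mono ennreal_leI) auto
  also have "\<dots> = ennreal K * ennreal (v - u)"
    using assms by (simp add: nn_integral_cmult_indicator)
  finally show ?thesis
    using assms divide_right_mono_ennreal[of _ "ennreal K * ennreal (v - u)" "ennreal (v - u)"]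
    by (simp add: avg_def mult_divide_eq_ennreal)
qed

lemma abs_le_max_endpoints: "x \<in> {u..v} \<Longrightarrow> \<bar>x\<bar> \<le> max \<bar>u\<bar> \<bar>v\<bar>" for x :: real
  by auto

text \<open>The average of \<open>\<bar>x\<bar> powr (-a)\<close> over an interval is governed by its value at the endpoint farthest from
  the origin. A short interval stays away from the origin, and there the weight is essentially
  constant; a long one is comparable to \<open>{-M..M}\<close>, where the integral costs the factor
  \<open>1 / (1 - a) = L\<close>. Measuring in \<open>M\<close> lets this bound be multiplied with the trivial
  one for the dual weight, whose value is largest at the same endpoint.\<close>

lemma avg_singular_power_le:
  assumes uv: "u < v" and L: "1 \<le> L"
  defines "a \<equiv> 1 - 1 / L" and "M \<equiv> max \<bar>u\<bar> \<bar>v\<bar>"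
  shows "avg u v (\<lambda>x. \<bar>x\<bar> powr (-a)) \<le> ennreal (4 * L * M powr (-a))"
proof -
  have a: "0 \<le> a" "a < 1" "1 - a = 1 / L"
    using L by (auto simp: a_def)
  have M: "0 < M"
    using uv by (auto simp: M_def)
  show ?thesis
  proof (cases "v - u < M / 2")
    case True
    have "\<bar>x\<bar> powr (-a) \<le> 4 * L * M powr (-a)" if "x \<in> {u..v}" for x
    proof -
      have "M / 2 \<le> \<bar>x\<bar>"
        using True that by (auto simp: M_def max_def abs_if split: if_splits)
      then have "\<bar>x\<bar> powr (-a) \<le> (M / 2) powr (-a)"
        using M a by (intro powr_mono2') auto
      also have "\<dots> = 2 powr a * M powr (-a)"
        using M by (simp add: powr_divide powr_minus field_simps)
      also have "2 powr a \<le> (2::real) powr 1"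
        using a by (intro powr_mono) auto
      also have "2 powr 1 \<le> 4 * L"
        using L by simp
      finally show ?thesis
        by (simp add: mult_right_mono)
    qed
    then show ?thesis
      using uv L by (intro avg_le) auto
  next
    case False
    have sub: "{u..v} \<subseteq> {-M..M}"
      unfolding M_def by auto
    have "(\<integral>\<^sup>+x\<in>{u..v}. ennreal (\<bar>x\<bar> powr (-a)) \<partial>lebesgue)
        \<le> (\<integral>\<^sup>+x\<in>{-M..M}. ennreal (\<bar>x\<bar> powr (-a)) \<partial>lebesgue)"
      by (intro set_nn_integral_mono order_refl sub)
    also have "\<dots> = ennreal (2 * L * M powr (1 - a))"
      using nn_integral_abs_powr[of a M] a M by (simp add: mult_ac)
    finally have "avg u v (\<lambda>x. \<bar>x\<bar> powr (-a)) \<le> ennreal (2 * L * M powr (1 - a)) / ennreal (v - u)"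
      unfolding avg_def by (rule divide_right_mono_ennreal)
    also have "\<dots> = ennreal (2 * L * M powr (1 - a) / (v - u))"
      using uv L by (intro divide_ennreal) auto
    also have "\<dots> \<le> ennreal (2 * L * M powr (1 - a) / (M / 2))"
      using False M L by (intro ennreal_leI divide_left_mono) auto
    also have "2 * L * M powr (1 - a) / (M / 2) = 4 * L * M powr (-a)"
      using M by (simp add: powr_diff powr_minus field_simps)
    finally show ?thesis .
  qed
qed

lemma weight_power:
  assumes "r > -1"
  shows "weight (\<lambda>x. \<bar>x\<bar> powr r)"
  unfolding weight_def
proof (intro conjI allI impI)
  fix K :: "real set"
  assume K: "compact K"
  obtain B where B: "\<And>x. x \<in> K \<Longrightarrow> \<bar>x\<bar> \<le> B"
    using compact_imp_bounded[OF K] by (auto simp: bounded_iff)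
  define M where "M = max 0 B"
  have sub: "K \<subseteq> {-M..M}"
    using B by (force simp: M_def)
  have "(\<integral>\<^sup>+x\<in>K. ennreal (\<bar>x\<bar> powr r) \<partial>lebesgue)
      \<le> (\<integral>\<^sup>+x\<in>{-M..M}. ennreal (\<bar>x\<bar> powr r) \<partial>lebesgue)"
    by (intro set_nn_integral_mono order_refl sub)
  also have "\<dots> < \<infinity>"
    using nn_integral_abs_powr[of "-r" M] assms by (simp add: M_def)
  finally have fin: "(\<integral>\<^sup>+x. ennreal (norm (indicator K x *\<^sub>R \<bar>x\<bar> powr r)) \<partial>lebesgue) < \<infinity>"
    by (simp add: indicator_mult_ennreal mult.commute ennreal_mult' flip: ennreal_indicator)
  have [measurable]: "K \<in> sets borel"
    using K by (simp add: compact_imp_closed)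
  have "(\<lambda>x. indicator K x *\<^sub>R \<bar>x\<bar> powr r) \<in> borel_measurable borel"
    by measurable
  then have "(\<lambda>x. indicator K x *\<^sub>R \<bar>x\<bar> powr r) \<in> borel_measurable lebesgue"
    by (simp add: measurable_completion)
  with fin show "set_integrable lebesgue K (\<lambda>x. \<bar>x\<bar> powr r)"
    unfolding set_integrable_def by (simp add: integrable_iff_bounded)
next
  have "AE x in lebesgue. x \<noteq> (0::real)"
    by (intro AE_I'[of "{0}"]) auto
  then show "AE x in lebesgue. 0 < \<bar>x\<bar> powr r"
    by eventually_elim simp
qed

lemma one_minus_conj_exp: "1 < p \<Longrightarrow> 1 - conj_exp p = - (1 / (p - 1))"
  by (simp add: conj_exp_def field_simps)

text \<open>The dual weight is a nonnegative power of \<open>\<bar>x\<bar>\<close>, hence at most its value at the endpoint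
  farthest from the origin. This value exactly compensates the factor \<open>M powr (-a)\<close> in the average of the
  weight.\<close>

lemma Ap_const_singular_power_le:
  assumes p: "1 < p" and L: "1 \<le> L"
  shows "Ap_const p (\<lambda>x. \<bar>x\<bar> powr (1 / L - 1)) \<le> ennreal (4 * L)"
  unfolding Ap_const_def
proof (rule SUP_least, clarify)
  fix u v :: real
  assume uv: "u < v"
  define M where "M = max \<bar>u\<bar> \<bar>v\<bar>"
  define a where "a = 1 - 1 / L"
  have a: "0 \<le> a" and M: "0 < M"
    using L uv by (auto simp: a_def M_def)
  have "(1 / L - 1) * (1 - conj_exp p) = a / (p - 1)"
    using p by (simp add: a_def one_minus_conj_exp diff_divide_distrib)
  then have "(\<bar>x\<bar> powr (1 / L - 1)) powr (1 - conj_exp p) = \<bar>x\<bar> powr (a / (p - 1))" for x :: real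
    by (simp add: powr_powr)
  moreover have "\<bar>x\<bar> powr (a / (p - 1)) \<le> M powr (a / (p - 1))" if "x \<in> {u..v}" for x
    using abs_le_max_endpoints[OF that] a p unfolding M_def by (intro powr_mono2) auto
  ultimately have "avg u v (\<lambda>x. (\<bar>x\<bar> powr (1 / L - 1)) powr (1 - conj_exp p))
      \<le> ennreal (M powr (a / (p - 1)))"
    using uv by (intro avg_le) auto
  then have "avg u v (\<lambda>x. (\<bar>x\<bar> powr (1 / L - 1)) powr (1 - conj_exp p)) ennpowr (p - 1)
      \<le> ennreal (M powr (a / (p - 1))) ennpowr (p - 1)"
    using p by (intro ennpowr_mono) auto
  also have "\<dots> = ennreal (M powr a)"
    using p by (simp add: ennpowr_ennreal powr_powr)
  finally have "avg u v (\<lambda>x. \<bar>x\<bar> powr (1 / L - 1)) *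
      avg u v (\<lambda>x. (\<bar>x\<bar> powr (1 / L - 1)) powr (1 - conj_exp p)) ennpowr (p - 1)
      \<le> ennreal (4 * L * M powr (-a)) * ennreal (M powr a)"
    using avg_singular_power_le[OF uv L] by (intro mult_mono) (auto simp: a_def M_def)
  also have "\<dots> = ennreal (4 * L)"
    using M L by (simp add: ennreal_mult[symmetric] powr_minus)
  finally show "avg u v (\<lambda>x. \<bar>x\<bar> powr (1 / L - 1)) *
      avg u v (\<lambda>x. (\<bar>x\<bar> powr (1 / L - 1)) powr (1 - conj_exp p)) ennpowr (p - 1)
      \<le> ennreal (4 * L)" .
qed

text \<open>The weights of the previous lemma with the roles of weight and dual weight exchanged: now the dual
  weight is \<open>\<bar>x\<bar> powr (-a)\<close>, and the outer exponent \<open>p - 1\<close> acts on the constant \<open>4 L\<close>.\<close>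

lemma Ap_const_degenerate_power_le:
  assumes p: "1 < p" and L: "1 \<le> L"
  shows "Ap_const p (\<lambda>x. \<bar>x\<bar> powr ((p - 1) * (1 - 1 / L))) \<le> ennreal ((4 * L) powr (p - 1))"
  unfolding Ap_const_def
proof (rule SUP_least, clarify)
  fix u v :: real
  assume uv: "u < v"
  define M where "M = max \<bar>u\<bar> \<bar>v\<bar>"
  define a where "a = 1 - 1 / L"
  let ?w = "\<lambda>x::real. \<bar>x\<bar> powr ((p - 1) * (1 - 1 / L))"
  have a: "0 \<le> a" and M: "0 < M"
    using L uv by (auto simp: a_def M_def)
  have "((p - 1) * (1 - 1 / L)) * (1 - conj_exp p) = -a"
    using p by (simp add: a_def one_minus_conj_exp)
  then have "?w x powr (1 - conj_exp p) = \<bar>x\<bar> powr (-a)" for x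
    by (simp add: powr_powr)
  then have "avg u v (\<lambda>x. ?w x powr (1 - conj_exp p)) \<le> ennreal (4 * L * M powr (-a))"
    using avg_singular_power_le[OF uv L] by (simp add: a_def M_def)
  then have "avg u v (\<lambda>x. ?w x powr (1 - conj_exp p)) ennpowr (p - 1)
      \<le> ennreal (4 * L * M powr (-a)) ennpowr (p - 1)"
    using p by (intro ennpowr_mono) auto
  also have "\<dots> = ennreal ((4 * L) powr (p - 1) * M powr (-((p - 1) * a)))"
    using L by (simp add: ennpowr_ennreal powr_mult powr_powr algebra_simps)
  finally have \<sigma>: "avg u v (\<lambda>x. ?w x powr (1 - conj_exp p)) ennpowr (p - 1)
      \<le> ennreal ((4 * L) powr (p - 1) * M powr (-((p - 1) * a)))" .
  have "?w x \<le> M powr ((p - 1) * a)" if "x \<in> {u..v}" for x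
    using abs_le_max_endpoints[OF that] a p unfolding M_def a_def by (intro powr_mono2) auto
  then have "avg u v ?w \<le> ennreal (M powr ((p - 1) * a))"
    using uv by (intro avg_le) auto
  with \<sigma> have "avg u v ?w * avg u v (\<lambda>x. ?w x powr (1 - conj_exp p)) ennpowr (p - 1)
      \<le> ennreal (M powr ((p - 1) * a)) * ennreal ((4 * L) powr (p - 1) * M powr (-((p - 1) * a)))"
    by (intro mult_mono) auto
  also have "\<dots> = ennreal ((4 * L) powr (p - 1))"
    using M L by (simp add: ennreal_mult[symmetric] powr_minus)
  finally show "avg u v ?w * avg u v (\<lambda>x. ?w x powr (1 - conj_exp p)) ennpowr (p - 1)
      \<le> ennreal ((4 * L) powr (p - 1))" .
qed

text \<open>The factor \<open>4\<close> in the bounds above makes them useless for \<open>t\<close> close to \<open>1\<close>. There the constant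
  weight takes over, which is the case \<open>L = 1\<close> of both families. It is written as a power
  that vanishes at the origin, so that it is literally a member of them.\<close>

lemma Ap_const_power_zero_le:
  assumes p: "1 < p"
  shows "Ap_const p (\<lambda>x. \<bar>x\<bar> powr 0) \<le> 1"
  unfolding Ap_const_def
proof (rule SUP_least, clarify)
  fix u v :: real
  assume uv: "u < v"
  have 1: "avg u v (\<lambda>x. \<bar>x\<bar> powr 0) \<le> ennreal 1"
    using uv by (intro avg_le) auto
  have "avg u v (\<lambda>x. (\<bar>x\<bar> powr 0) powr (1 - conj_exp p)) \<le> ennreal 1"
    using uv by (intro avg_le) auto
  then have "avg u v (\<lambda>x. (\<bar>x\<bar> powr 0) powr (1 - conj_exp p)) ennpowr (p - 1) \<le> 1 ennpowr (p - 1)"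
    using p by (intro ennpowr_mono) auto
  also have "\<dots> = ennreal 1"
    by (simp add: ennpowr_def)
  finally show "avg u v (\<lambda>x. \<bar>x\<bar> powr 0) *
      avg u v (\<lambda>x. (\<bar>x\<bar> powr 0) powr (1 - conj_exp p)) ennpowr (p - 1) \<le> 1"
    using mult_mono[OF 1] by fastforce
qed

section \<open>The two extremal examples\<close>

lemma has_integral_inverse:
  fixes L :: real
  assumes "0 \<le> L"
  shows "((\<lambda>y. 1 / y) has_integral L) {exp (-L)..1}"
proof -
  have pos: "0 < y" if "y \<in> {exp (-L)..1}" for y
    using that less_le_trans[OF exp_gt_zero, of "-L" y] by simp
  have "((\<lambda>y. 1 / y) has_integral (ln 1 - ln (exp (-L)))) {exp (-L)..1}"
    using assms by (intro fundamental_theorem_of_calculus)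
      (auto intro!: derivative_eq_intros simp: pos has_real_derivative_iff_has_vector_derivative[symmetric])
  then show ?thesis by simp
qed

lemma has_integral_ln_div:
  fixes c L :: real
  assumes "0 \<le> L"
  shows "((\<lambda>y. (ln y + c) / y) has_integral (c\<^sup>2 / 2 - (c - L)\<^sup>2 / 2)) {exp (-L)..1}"
proof -
  have pos: "0 < y" if "y \<in> {exp (-L)..1}" for y
    using that less_le_trans[OF exp_gt_zero, of "-L" y] by simp
  have deriv: "((\<lambda>y. (ln y + c)\<^sup>2 / 2) has_real_derivative (ln y + c) / y) (at y within S)"
    if "0 < y" for y S
    using that by (auto intro!: derivative_eq_intros) (simp add: field_simps)
  have "((\<lambda>y. (ln y + c) / y) has_integral
      ((ln 1 + c)\<^sup>2 / 2 - (ln (exp (-L)) + c)\<^sup>2 / 2)) {exp (-L)..1}"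
    using assms by (intro fundamental_theorem_of_calculus)
      (simp_all add: deriv pos has_real_derivative_iff_has_vector_derivative[symmetric])
  then show ?thesis by (simp add: algebra_simps power2_eq_square)
qed

lemma compactly_supportedI:
  assumes "\<And>y. y \<notin> {a..b} \<Longrightarrow> f y = 0"
  shows "compactly_supported f"
proof -
  have "x \<in> {a..b}" if "f x \<noteq> 0" for x
    using assms[of x] that by metis
  then have "{x. f x \<noteq> 0} \<subseteq> {a..b}"
    by blast
  then have "bounded {x. f x \<noteq> 0}"
    by (rule bounded_subset[rotated]) simp
  then show ?thesis
    by (simp add: compactly_supported_def compact_closure)
qed

text \<open>Logarithms enter twice, through \<open>b y - b x\<close> and through the integral of the kernel \<open>1 / (y - x)\<close>
  over \<open>{s..1}\<close>, and each of them contributes a factor \<open>L\<close> for \<open>x\<close> in \<open>{0<..<s}\<close>. The weight gives the interval \<open>{0<..<s}\<close> as much mass, up to a constant, as the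
  support of the test function.\<close>

lemma weak_op_norm_singular_power_ge:
  assumes p: "1 < p" and L: "1 \<le> L"
  shows "ennreal (exp (-1 / p) / (4 * pi) * L\<^sup>2)
    \<le> weak_op_norm p (\<lambda>x. \<bar>x\<bar> powr (1 / L - 1)) (commutator (\<lambda>x. ln \<bar>x\<bar>) hilbert)"
proof -
  define s where "s = exp (-L)"
  define f :: "real \<Rightarrow> real" where "f = indicator {s..1}"
  have s: "0 < s" "s < 1" "ln s = -L"
    using L by (auto simp: s_def)
  let ?w = "\<lambda>x::real. \<bar>x\<bar> powr (1 / L - 1)"
  \<comment> \<open>the commutator is at least \<open>L\<^sup>2 / (2 * pi)\<close>; half of that is a level which it strictly exceeds\<close>
  have "ennreal (L\<^sup>2 / (4 * pi) * (exp (-1) * L / L) powr (1 / p))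
    \<le> weak_op_norm p ?w (commutator (\<lambda>x. ln \<bar>x\<bar>) hilbert)"
  proof (rule weak_op_norm_ge[OF p, where f = f and A = "{0<..<s}"])
    show "f \<in> borel_measurable lebesgue"
      by (simp add: f_def measurable_completion)
    show "compactly_supported f"
      by (rule compactly_supportedI[of s 1]) (auto simp: f_def)
    have "(\<integral>\<^sup>+x. ennreal (\<bar>f x\<bar> powr p * ?w x) \<partial>lebesgue)
        = (\<integral>\<^sup>+x\<in>{s..1}. ennreal (?w x) \<partial>lebesgue)"
      by (intro nn_integral_cong) (auto simp: f_def indicator_def)
    also have "\<dots> \<le> (\<integral>\<^sup>+x\<in>{s..1}. ennreal (1 / x) \<partial>lebesgue)"
    proof (intro set_nn_integral_mono ennreal_leI order_refl)
      fix x assume x: "x \<in> {s..1}"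
      then have "x powr (1 / L) \<le> 1"
        using s L by (intro powr_le1) auto
      then show "?w x \<le> 1 / x"
        using x s by (simp add: powr_diff divide_right_mono)
    qed
    also have "\<dots> = ennreal L"
      using s L has_integral_inverse[of L] unfolding s_def[symmetric]
      by (intro nn_integral_lebesgue_has_integral) auto
    finally show "(\<integral>\<^sup>+x. ennreal (\<bar>f x\<bar> powr p * ?w x) \<partial>lebesgue) \<le> ennreal L" .
  next
    fix x assume x: "x \<in> {0<..<s}"
    have "L\<^sup>2 / 2 / pi \<le> commutator (\<lambda>x. ln \<bar>x\<bar>) hilbert f x"
    proof (rule commutator_log_ge[where a = s and b = 1])
      show "continuous_on {s..1} f"
        by (rule continuous_on_eq[of _ "\<lambda>_. 1"]) (auto simp: f_def)
      show "((\<lambda>y. (ln y + L) / y) has_integral L\<^sup>2 / 2) {s..1}"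
        using has_integral_ln_div[of L L] L by (simp add: s_def)
      show "(ln y + L) / y \<le> (ln x - ln y) * f y / (x - y)" if y: "y \<in> {s..1}" for y
      proof -
        have "ln x \<le> ln s" "ln s \<le> ln y"
          using x y s(1) by auto
        \<comment> \<open>replacing \<open>x\<close> by \<open>s\<close> decreases the numerator, replacing it by \<open>0\<close> increases the denominator\<close>
        then have "(ln y + L) / y \<le> (ln y - ln x) / (y - x)"
          using x y s by (intro frac_le) auto
        also have "\<dots> = (ln x - ln y) * f y / (x - y)"
          using y x by (simp add: f_def divide_simps) (simp add: algebra_simps)
        finally show ?thesis .
      qed
    qed (use s x in \<open>auto simp: f_def\<close>)
    moreover have "0 < L\<^sup>2 / pi"
      using L by (intro divide_pos_pos) auto
    ultimately show "L\<^sup>2 / (4 * pi) < commutator (\<lambda>x. ln \<bar>x\<bar>) hilbert f x"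
      by simp
  next
    have "(?w has_integral s powr (1 / L) * L) {0..s}"
      using has_integral_powr_from_0[of "1 / L - 1" s] L s
      by (subst has_integral_cong[where g = "\<lambda>x. x powr (1 / L - 1)"]) (auto simp: mult.commute)
    then have "((\<lambda>x. ?w x) has_integral s powr (1 / L) * L) {0<..<s}"
      by (simp add: has_integral_Icc_iff_Ioo)
    moreover have "s powr (1 / L) = exp (-1)"
      using L s by (simp add: powr_def)
    ultimately show "ennreal (exp (-1) * L) \<le> wmeasure ?w {0<..<s}"
      unfolding wmeasure_def by (subst nn_integral_lebesgue_has_integral) auto
  qed (use L in auto)
  also have "exp (-1) * L / L = exp (-1)"
    using L by simp
  also have "exp (-1) powr (1 / p) = exp (-1 / p)"
    by (simp add: powr_def)
  finally show ?thesis
    by (simp add: mult.commute)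
qed

text \<open>Here the test function \<open>1 / y\<close> is the critical power to which the dual weight
  \<open>y powr (1 / L - 1)\<close> is comparable on \<open>{s..1}\<close>. The singularities of \<open>f\<close> and \<open>b\<close> at the origin multiply, and the
  commutator carries the result to a place where the weight has size one.\<close>

lemma weak_op_norm_degenerate_power_ge:
  assumes p: "1 < p" and L: "1 \<le> L"
  shows "ennreal (exp ((1 - p) / p) / (8 * pi) * L powr (2 - 1 / p))
    \<le> weak_op_norm p (\<lambda>x. \<bar>x\<bar> powr ((p - 1) * (1 - 1 / L))) (commutator (\<lambda>x. ln \<bar>x\<bar>) hilbert)"
proof -
  define s where "s = exp (-L)"
  define f :: "real \<Rightarrow> real" where "f = (\<lambda>y. indicator {s..1} y * (1 / y))"
  have s: "0 < s" "s < 1" "ln s = -L"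
    using L by (auto simp: s_def)
  let ?w = "\<lambda>x::real. \<bar>x\<bar> powr ((p - 1) * (1 - 1 / L))"
  \<comment> \<open>the commutator is at least \<open>L\<^sup>2 / (4 * pi)\<close>; half of that is a level which it strictly exceeds\<close>
  have "ennreal (L\<^sup>2 / (8 * pi) * (1 / (exp (p - 1) * L)) powr (1 / p))
    \<le> weak_op_norm p ?w (commutator (\<lambda>x. ln \<bar>x\<bar>) hilbert)"
  proof (rule weak_op_norm_ge[OF p, where f = f and A = "{1<..<2}"])
    have "f \<in> borel_measurable borel"
      unfolding f_def by measurable
    then show "f \<in> borel_measurable lebesgue"
      by (simp add: measurable_completion)
    show "compactly_supported f"
      by (rule compactly_supportedI[of s 1]) (auto simp: f_def)
    have "(\<integral>\<^sup>+x. ennreal (\<bar>f x\<bar> powr p * ?w x) \<partial>lebesgue)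
        = (\<integral>\<^sup>+x\<in>{s..1}. ennreal ((1 / x) powr p * ?w x) \<partial>lebesgue)"
      using s by (intro nn_integral_cong) (auto simp: f_def indicator_def)
    \<comment> \<open>the integrand is \<open>x powr (-1 - (p - 1) / L)\<close>, and \<open>x powr (-1 / L) \<le> exp 1\<close> for \<open>x \<ge> s\<close>\<close>
    also have "\<dots> \<le> (\<integral>\<^sup>+x\<in>{s..1}. ennreal (exp (p - 1) * (1 / x)) \<partial>lebesgue)"
    proof (intro set_nn_integral_mono ennreal_leI order_refl)
      fix x assume x: "x \<in> {s..1}"
      then have "0 < x" "ln s \<le> ln x"
        using s(1) by auto
      then have "-L \<le> ln x"
        by (simp only: s(3))
      have "(1 / x) powr p * ?w x = exp (- (p * ln x) + (p - 1) * (1 - 1 / L) * ln x)"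
        using \<open>0 < x\<close> unfolding exp_add by (simp add: powr_def ln_div)
      also have "- (p * ln x) + (p - 1) * (1 - 1 / L) * ln x = (p - 1) * (- ln x / L) - ln x"
        by (simp add: algebra_simps)
      also have "exp ((p - 1) * (- ln x / L) - ln x) \<le> exp ((p - 1) * 1 - ln x)"
      proof -
        have "- ln x / L \<le> L / L"
          using \<open>-L \<le> ln x\<close> L by (intro divide_right_mono) auto
        then have "- ln x / L \<le> 1"
          using L by simp
        then show ?thesis
          using p by (intro exp_le_cancel_iff[THEN iffD2] diff_right_mono mult_left_mono) auto
      qed
      also have "\<dots> = exp (p - 1) * (1 / x)"
        using \<open>0 < x\<close> by (simp add: exp_diff)
      finally show "(1 / x) powr p * ?w x \<le> exp (p - 1) * (1 / x)" .
    qed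
    also have "\<dots> = ennreal (exp (p - 1) * L)"
      using s L has_integral_mult_right[OF has_integral_inverse[of L]] unfolding s_def[symmetric]
      by (intro nn_integral_lebesgue_has_integral) auto
    finally show "(\<integral>\<^sup>+x. ennreal (\<bar>f x\<bar> powr p * ?w x) \<partial>lebesgue) \<le> ennreal (exp (p - 1) * L)" .
  next
    fix x :: real assume x: "x \<in> {1<..<2}"
    have "L\<^sup>2 / 4 / pi \<le> commutator (\<lambda>x. ln \<bar>x\<bar>) hilbert f x"
    proof (rule commutator_log_ge[where a = s and b = 1])
      show "continuous_on {s..1} f"
      proof (rule continuous_on_eq)
        show "continuous_on {s..1} (\<lambda>y. 1 / y)"
          using s by (intro continuous_intros) auto
      qed (simp add: f_def)
      show "((\<lambda>y. - 1 / 2 * ((ln y + 0) / y)) has_integral L\<^sup>2 / 4) {s..1}"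
        using has_integral_mult_right[OF has_integral_ln_div[of L 0], of "- 1 / 2"] L
        by (simp add: s_def)
      show "- 1 / 2 * ((ln y + 0) / y) \<le> (ln x - ln y) * f y / (x - y)" if y: "y \<in> {s..1}" for y
      proof -
        have "0 < y"
          using y s by auto
        have "ln y \<le> 0" "0 \<le> ln x"
          using x y \<open>0 < y\<close> by auto
        then have "(- ln y) / 2 \<le> (ln x - ln y) / (x - y)"
          using x y s by (intro frac_le) auto
        then have "(- ln y) / 2 * (1 / y) \<le> (ln x - ln y) / (x - y) * (1 / y)"
          using \<open>0 < y\<close> by (intro mult_right_mono) auto
        then show ?thesis
          using y by (simp add: f_def mult.commute)
      qed
    qed (use s x in \<open>auto simp: f_def\<close>)
    moreover have "0 < L\<^sup>2 / pi"
      using L by (intro divide_pos_pos) auto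
    ultimately show "L\<^sup>2 / (8 * pi) < commutator (\<lambda>x. ln \<bar>x\<bar>) hilbert f x"
      by simp
  next
    have "(\<integral>\<^sup>+x\<in>{1<..<2::real}. ennreal 1 \<partial>lebesgue) \<le> wmeasure ?w {1<..<2}"
      unfolding wmeasure_def using p L
      by (intro set_nn_integral_mono ennreal_leI ge_one_powr_ge_zero) auto
    then show "ennreal 1 \<le> wmeasure ?w {1<..<2}"
      by simp
  qed (use L in auto)
  also have "L\<^sup>2 / (8 * pi) * (1 / (exp (p - 1) * L)) powr (1 / p)
      = exp ((1 - p) / p) / (8 * pi) * L powr (2 - 1 / p)"
  proof -
    have "(1 / (exp (p - 1) * L)) powr (1 / p) = (exp (1 - p) * (1 / L)) powr (1 / p)"
      by (simp add: exp_diff)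
    also have "\<dots> = exp ((1 - p) / p) * (1 / L powr (1 / p))"
      using L by (simp add: powr_mult powr_divide powr_def[of "exp _"])
    finally have "(1 / (exp (p - 1) * L)) powr (1 / p) = exp ((1 - p) / p) * (1 / L powr (1 / p))" .
    moreover have "L powr (2 - 1 / p) = L\<^sup>2 * (1 / L powr (1 / p))"
      using L by (simp add: powr_diff)
    ultimately show ?thesis
      by simp
  qed
  finally show ?thesis .
qed

section \<open>Growth of the optimal bound\<close>

lemma phi_ge:
  assumes "weight w" "Ap_const p w \<le> ennreal t" "ennreal C \<le> weak_op_norm p w (commutator b T)"
  shows "ennreal C \<le> phi p b T t"
  unfolding phi_def
proof (rule SUP_upper2)
  show "w \<in> {w \<in> Ap p. Ap_const p w \<le> ennreal t}"
    using assms(1,2) by (auto simp: Ap_def intro: le_less_trans)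
qed (rule assms(3))

text \<open>For \<open>t \<ge> 4\<close> the weight with \<open>L = t / 4\<close> is admissible; for smaller \<open>t\<close> the constant weight is,
  and the claimed bound is then weaker than the one at \<open>L = 1\<close>.\<close>

lemma phi_log_hilbert_ge_square:
  assumes p: "1 < p" and t: "1 \<le> t"
  shows "ennreal (exp (-1 / p) / (4 * pi) * (t / 4)\<^sup>2) \<le> phi p (\<lambda>x. ln \<bar>x\<bar>) hilbert t"
proof -
  define L where "L = max 1 (t / 4)"
  have L: "1 \<le> L" "t / 4 \<le> L"
    by (auto simp: L_def)
  have "ennreal (exp (-1 / p) / (4 * pi) * (t / 4)\<^sup>2) \<le> ennreal (exp (-1 / p) / (4 * pi) * L\<^sup>2)"
    using t L by (intro ennreal_leI mult_left_mono power_mono) auto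
  also have "\<dots> \<le> phi p (\<lambda>x. ln \<bar>x\<bar>) hilbert t"
  proof (rule phi_ge[OF _ _ weak_op_norm_singular_power_ge[OF p L(1)]])
    show "weight (\<lambda>x. \<bar>x\<bar> powr (1 / L - 1))"
      using L by (intro weight_power) auto
    show "Ap_const p (\<lambda>x. \<bar>x\<bar> powr (1 / L - 1)) \<le> ennreal t"
    proof (cases "t < 4")
      case True
      then have "L = 1" by (simp add: L_def)
      then show ?thesis
        using Ap_const_power_zero_le[OF p] t by (auto intro: order_trans)
    next
      case False
      then have "t = 4 * L" by (simp add: L_def)
      then show ?thesis
        using Ap_const_singular_power_le[OF p L(1)] by simp
    qed
  qed
  finally show ?thesis .
qed

text \<open>The weight with \<open>(4 L) powr (p - 1) = t\<close> is admissible as soon as this gives \<open>L \<ge> 1\<close>; otherwise the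
  constant weight is.\<close>

lemma phi_log_hilbert_ge_powr:
  assumes p: "1 < p" and t: "1 \<le> t"
  shows "ennreal (exp ((1 - p) / p) / (8 * pi) * (t powr (1 / (p - 1)) / 4) powr (2 - 1 / p))
    \<le> phi p (\<lambda>x. ln \<bar>x\<bar>) hilbert t"
proof -
  define \<tau> where "\<tau> = t powr (1 / (p - 1))"
  define L where "L = max 1 (\<tau> / 4)"
  have L: "1 \<le> L" "\<tau> / 4 \<le> L"
    by (auto simp: L_def)
  have \<tau>: "0 \<le> \<tau>" "\<tau> powr (p - 1) = t"
    using p t by (auto simp: \<tau>_def powr_powr)
  have "1 / p \<le> 1"
    using p by simp
  have "ennreal (exp ((1 - p) / p) / (8 * pi) * (\<tau> / 4) powr (2 - 1 / p))
      \<le> ennreal (exp ((1 - p) / p) / (8 * pi) * L powr (2 - 1 / p))"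
    using \<open>1 / p \<le> 1\<close> L \<tau> by (intro ennreal_leI mult_left_mono powr_mono2) auto
  also have "\<dots> \<le> phi p (\<lambda>x. ln \<bar>x\<bar>) hilbert t"
  proof (rule phi_ge[OF _ _ weak_op_norm_degenerate_power_ge[OF p L(1)]])
    have "0 \<le> (p - 1) * (1 - 1 / L)"
      using p L by (intro mult_nonneg_nonneg) auto
    then show "weight (\<lambda>x. \<bar>x\<bar> powr ((p - 1) * (1 - 1 / L)))"
      by (intro weight_power) auto
    show "Ap_const p (\<lambda>x. \<bar>x\<bar> powr ((p - 1) * (1 - 1 / L))) \<le> ennreal t"
    proof (cases "\<tau> < 4")
      case True
      then have "L = 1" by (simp add: L_def)
      then show ?thesis
        using Ap_const_power_zero_le[OF p] t by (auto intro: order_trans)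
    next
      case False
      then have "\<tau> = 4 * L" by (simp add: L_def)
      then show ?thesis
        using Ap_const_degenerate_power_le[OF p L(1)] \<tau> by simp
    qed
  qed
  finally show ?thesis
    by (simp add: \<tau>_def)
qed

theorem theorem1p1:
  fixes p :: real
  assumes "1 < p"
  shows "\<exists>c::real. 0 < c \<and> (\<forall>t\<ge>1.
           ennreal (c * t powr (max 2 (1 / p + conj_exp p / p)))
             \<le> phi p (\<lambda>x. ln \<bar>x\<bar>) hilbert t)"
proof -
  define e where "e = 1 / p + conj_exp p / p"
  define c1 where "c1 = exp (-1 / p) / (4 * pi) / 16"
  define c2 where "c2 = exp ((1 - p) / p) / (8 * pi) / 4 powr (2 - 1 / p)"
  have c: "0 < c1" "0 < c2"
    by (auto simp: c1_def c2_def)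
  have e: "1 / (p - 1) * (2 - 1 / p) = e"
    using assms by (simp add: e_def conj_exp_def divide_simps)
  have "ennreal (min c1 c2 * t powr max 2 e) \<le> phi p (\<lambda>x. ln \<bar>x\<bar>) hilbert t" if t: "1 \<le> t" for t
  proof (cases "e \<le> 2")
    case True
    then have "min c1 c2 * t powr max 2 e \<le> c1 * t\<^sup>2"
      using t by (simp add: max_absorb1)
    also have "\<dots> = exp (-1 / p) / (4 * pi) * (t / 4)\<^sup>2"
      by (simp add: c1_def power_divide)
    finally show ?thesis
      using phi_log_hilbert_ge_square[OF assms t] by (blast intro: order_trans ennreal_leI)
  next
    case False
    then have "min c1 c2 * t powr max 2 e \<le> c2 * t powr e"
      by (simp add: max_absorb2 mult_right_mono)
    also have "\<dots> = exp ((1 - p) / p) / (8 * pi) * (t powr (1 / (p - 1)) / 4) powr (2 - 1 / p)"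
      unfolding c2_def powr_divide powr_powr e by (simp only: times_divide_eq_left times_divide_eq_right)
    finally show ?thesis
      using phi_log_hilbert_ge_powr[OF assms t] by (blast intro: order_trans ennreal_leI)
  qed
  then show ?thesis
    using c by (intro exI[of _ "min c1 c2"]) (auto simp: e_def)
qed

end
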